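(* The rank reduction problem can be solved in polynomial time on partition matroids; that is, there is a polynomial-time algorithm which, given a model $((E_1,d_1),\dots,(E_p,d_p))$ of a partition matroid $M$ with ground set $E=E_1\cup\cdots\cup E_p$ and rank function $r$, together with a positive integer $k$, outputs a minimum-size set $X\subseteq E$ such that $r(E\setminus X)\le r(E)-k$.
   Context: A partition matroid is given by a model $((E_1,d_1),\dots,(E_p,d_p))$, where $E_1,\dots,E_p$ are pairwise disjoint finite sets and $d_1,\dots,d_p$ are integers with $0\le d_i\le |E_i|$ for each $i\in\{1,\dots,p\}$. Its ground set is $E=E_1\cup\cdots\cup E_p$, and $X\subseteq E$ is independent iff $|E_i\cap X|\le d_i$ for every $i\in\{1,\dots,p\}$. The rank $r(X)$ of $X\subseteq E$ is the maximum size of an independent set contained in $X$. The rank reduction problem: given a matroid on ground set $E$ with rank function $r$ and a positive integer $k$, find a minimum-size subset $X\subseteq E$ with $r(E\setminus X)\le r(E)-k$. The matroid is given as input via its model (not as an explicit set system), and the input size is measured accordingly.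
   Formalization: The algorithm is only required to succeed when k ≤ r(E), i.e. when some X with r(E∖X) ≤ r(E)−k exists; for k > r(E) no such X exists, so the claim as written has no meaning there. *)

theory Defs
  imports Main
begin

text \<open>A model ((E_1,d_1),...,(E_p,d_p)) is a list of blocks; a block is a pair of a list of
  element names (natural numbers) and a capacity d_i.\<close>

type_synonym pm_model = "(nat list \<times> nat) list"

definition pm_valid :: "pm_model \<Rightarrow> bool" where
  "pm_valid B \<longleftrightarrow> distinct (concat (map fst B)) \<and> (\<forall>b \<in> set B. snd b \<le> length (fst b))"

definition pm_ground :: "pm_model \<Rightarrow> nat set" where
  "pm_ground B = (\<Union>b \<in> set B. set (fst b))"

definition pm_indep :: "pm_model \<Rightarrow> nat set \<Rightarrow> bool" where
  "pm_indep B X \<longleftrightarrow> X \<subseteq> pm_ground B \<and> (\<forall>b \<in> set B. card (set (fst b) \<inter> X) \<le> snd b)"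

definition pm_rank :: "pm_model \<Rightarrow> nat set \<Rightarrow> nat" where
  "pm_rank B X = Max (card ` {I. I \<subseteq> X \<and> pm_indep B I})"

definition rank_reducing :: "pm_model \<Rightarrow> nat \<Rightarrow> nat set \<Rightarrow> bool" where
  "rank_reducing B k X \<longleftrightarrow> X \<subseteq> pm_ground B \<and>
     int (pm_rank B (pm_ground B - X)) \<le> int (pm_rank B (pm_ground B)) - int k"

datatype instr =
    Const nat nat
  | Add nat nat nat
  | Sub nat nat nat
  | Load nat nat
  | Store nat nat
  | Jz nat nat
  | Jmp nat

type_synonym state = "nat \<times> (nat \<Rightarrow> nat)"

fun exec :: "instr \<Rightarrow> state \<Rightarrow> state" where
  "exec (Const a c) (pc, m) = (Suc pc, m(a := c))"
| "exec (Add a b c) (pc, m) = (Suc pc, m(a := m b + m c))"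
| "exec (Sub a b c) (pc, m) = (Suc pc, m(a := m b - m c))"
| "exec (Load a b) (pc, m) = (Suc pc, m(a := m (m b)))"
| "exec (Store a b) (pc, m) = (Suc pc, m(m a := m b))"
| "exec (Jz a l) (pc, m) = (if m a = 0 then l else Suc pc, m)"
| "exec (Jmp l) (pc, m) = (l, m)"

definition step :: "instr list \<Rightarrow> state \<Rightarrow> state" where
  "step P s = (if fst s < length P then exec (P ! fst s) s else s)"

definition run :: "instr list \<Rightarrow> nat \<Rightarrow> state \<Rightarrow> state" where
  "run P t s = (step P ^^ t) s"

definition halted :: "instr list \<Rightarrow> state \<Rightarrow> bool" where
  "halted P s \<longleftrightarrow> length P \<le> fst s"

definition init_state :: "nat list \<Rightarrow> state" where
  "init_state ws = (0, \<lambda>i. if i = 0 then length ws else if i \<le> length ws then ws ! (i - 1) else 0)"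

definition ram_output :: "state \<Rightarrow> nat list" where
  "ram_output s = map (\<lambda>i. snd s (Suc i)) [0..<snd s 0]"

fun bitlen :: "nat \<Rightarrow> nat" where
  "bitlen n = (if n = 0 then 0 else Suc (bitlen (n div 2)))"

definition enc_size :: "nat list \<Rightarrow> nat" where
  "enc_size ws = (\<Sum>w \<leftarrow> ws. Suc (bitlen w))"

definition enc_instance :: "pm_model \<Rightarrow> nat \<Rightarrow> nat list" where
  "enc_instance B k = [k, length B] @ concat (map (\<lambda>(es, d). [length es, d] @ es) B)"

end

(* Deleting x elements of a block (E_i, d_i) lowers the rank by x - (|E_i| - d_i), truncated at 0:
   the first |E_i| - d_i deletions are lost, every further one counts. Hence a minimum solution has
   size k plus the smallest number of lost deletions, a knapsack problem in which block i has
   capacity d_i and fixed cost |E_i| - d_i. If k is feasible then k is at most the number of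
   elements, so a dynamic program over blocks and amounts j <= k takes polynomial time although k
   is given in binary. The solution is read off the table backwards. *)
theory Submission
  imports Defs
begin

section \<open>Rank reduction as a knapsack problem\<close>

text \<open>The lost deletions of a block are a fixed charge: once a block is used at all, their
  number does not depend on how much rank it contributes. A used block may therefore contribute its
  whole capacity or the remaining demand, whichever is smaller. Each table entry is thus a minimum
  of two values, with no search over amounts inside a block. Optimality is a comparison of counts:
  every reducing set has at least \<open>overhead + k\<close> elements, and the list read off has
  exactly that length. The obstacle is the machine. Input and output both occupy the low addresses
  where the registers live, and subtraction truncates at 0. Hence output, input and table get
  separate regions whose positions follow from the input length alone, and minima and comparisons
  are expressed by truncated differences. Much of the work below is showing that these regions do
  not overlap.\<close>

definition excess :: "pm_model \<Rightarrow> nat set \<Rightarrow> nat" where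
  "excess B X = (\<Sum>b\<leftarrow>B. card (set (fst b) \<inter> X) - (length (fst b) - snd b))"

lemma pm_ground_Nil [simp]: "pm_ground [] = {}"
  and pm_ground_Cons [simp]: "pm_ground (b # B) = set (fst b) \<union> pm_ground B"
  by (auto simp: pm_ground_def)

lemma finite_pm_ground [simp]: "finite (pm_ground B)"
  by (simp add: pm_ground_def)

lemma pm_ground_eq: "pm_ground B = set (concat (map fst B))"
  by (auto simp: pm_ground_def)

lemma pm_valid_ConsD:
  assumes "pm_valid (b # B)"
  shows "pm_valid B" "set (fst b) \<inter> pm_ground B = {}" "distinct (fst b)" "snd b \<le> length (fst b)"
  using assms by (force simp: pm_valid_def pm_ground_eq)+

section \<open>Rank and rank drop, block by block\<close>

lemma card_Int_pm_ground:
  assumes "pm_valid B"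
  shows "card (pm_ground B \<inter> X) = (\<Sum>b\<leftarrow>B. card (set (fst b) \<inter> X))"
  using assms
proof (induction B)
  case (Cons b B)
  have "card (pm_ground (b # B) \<inter> X) = card ((set (fst b) \<inter> X) \<union> (pm_ground B \<inter> X))"
    by (simp add: Int_Un_distrib2)
  also have "\<dots> = card (set (fst b) \<inter> X) + card (pm_ground B \<inter> X)"
    using pm_valid_ConsD(2)[OF Cons.prems] by (intro card_Un_disjoint) auto
  finally show ?case
    using Cons.IH[OF pm_valid_ConsD(1)[OF Cons.prems]] by simp
qed simp

text \<open>Attains the upper bound in \<open>pm_rank_eq\<close>: elements are chosen in each block
  separately, and disjointness keeps the choice in one block from counting against the capacity of
  another.\<close>

lemma ex_pm_indep:
  assumes "pm_valid B"
  shows "\<exists>I. I \<subseteq> X \<and> pm_indep B I \<and> card I = (\<Sum>b\<leftarrow>B. min (snd b) (card (set (fst b) \<inter> X)))"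
  using assms
proof (induction B)
  case Nil
  show ?case by (intro exI[of _ "{}"]) (simp add: pm_indep_def)
next
  case (Cons b B)
  note v = pm_valid_ConsD[OF Cons.prems]
  from Cons.IH[OF v(1)] obtain I where I: "I \<subseteq> X" "pm_indep B I"
    "card I = (\<Sum>b\<leftarrow>B. min (snd b) (card (set (fst b) \<inter> X)))" by blast
  obtain J where J: "J \<subseteq> set (fst b) \<inter> X" "card J = min (snd b) (card (set (fst b) \<inter> X))"
    by (meson obtain_subset_with_card_n min.cobounded2)
  have IG: "I \<subseteq> pm_ground B" using I(2) by (simp add: pm_indep_def)
  have "card (I \<union> J) = card I + card J"
    using IG J(1) v(2) by (intro card_Un_disjoint) (auto intro: finite_subset)
  moreover have "set (fst b) \<inter> (I \<union> J) = J"
    using IG J(1) v(2) by auto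
  moreover have "set (fst c) \<inter> (I \<union> J) = set (fst c) \<inter> I" if "c \<in> set B" for c
    using that J(1) v(2) by (auto simp: pm_ground_def)
  ultimately show ?case
    using I J IG by (intro exI[of _ "I \<union> J"]) (auto simp: pm_indep_def)
qed

lemma pm_rank_eq:
  assumes "pm_valid B"
  shows "pm_rank B X = (\<Sum>b\<leftarrow>B. min (snd b) (card (set (fst b) \<inter> X)))"
  unfolding pm_rank_def
proof (rule Max_eqI)
  show "finite (card ` {I. I \<subseteq> X \<and> pm_indep B I})"
    by (rule finite_imageI, rule finite_subset[of _ "Pow (pm_ground B)"]) (auto simp: pm_indep_def)
next
  fix n assume "n \<in> card ` {I. I \<subseteq> X \<and> pm_indep B I}"
  then obtain I where I: "I \<subseteq> X" "pm_indep B I" "n = card I" by blast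
  have "n = card (pm_ground B \<inter> I)"
    using I by (simp add: pm_indep_def inf.absorb2)
  also have "\<dots> = (\<Sum>b\<leftarrow>B. card (set (fst b) \<inter> I))"
    by (rule card_Int_pm_ground[OF assms])
  also have "\<dots> \<le> (\<Sum>b\<leftarrow>B. min (snd b) (card (set (fst b) \<inter> X)))"
    using I by (intro sum_list_mono) (auto simp: pm_indep_def intro!: card_mono)
  finally show "n \<le> (\<Sum>b\<leftarrow>B. min (snd b) (card (set (fst b) \<inter> X)))" .
next
  show "(\<Sum>b\<leftarrow>B. min (snd b) (card (set (fst b) \<inter> X))) \<in> card ` {I. I \<subseteq> X \<and> pm_indep B I}"
    using ex_pm_indep[OF assms, of X] by (metis (mono_tags, lifting) imageI mem_Collect_eq)
qed

text \<open>For a block with n elements, capacity d and x deletions this is the identity min d (n -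
  x) + (x - (n - d)) = d, which holds with truncated subtraction because x and d are at most n. The
  additive form avoids a difference of ranks.\<close>

lemma pm_rank_Diff:
  assumes "pm_valid B"
  shows "pm_rank B (pm_ground B - X) + excess B X = pm_rank B (pm_ground B)"
proof -
  have "min (snd b) (card (set (fst b) \<inter> (pm_ground B - X)))
      + (card (set (fst b) \<inter> X) - (length (fst b) - snd b))
      = min (snd b) (card (set (fst b) \<inter> pm_ground B))" if "b \<in> set B" for b
  proof -
    have "distinct (fst b)" "snd b \<le> length (fst b)"
      using assms that by (auto simp: pm_valid_def distinct_concat_iff)
    moreover have "set (fst b) \<inter> (pm_ground B - X) = set (fst b) - set (fst b) \<inter> X"
      "set (fst b) \<inter> pm_ground B = set (fst b)"
      using that by (auto simp: pm_ground_def)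
    moreover have "card (set (fst b) - set (fst b) \<inter> X) = card (set (fst b)) - card (set (fst b) \<inter> X)"
      by (intro card_Diff_subset) auto
    moreover have "card (set (fst b) \<inter> X) \<le> card (set (fst b))"
      by (intro card_mono) auto
    ultimately show ?thesis
      by (simp add: distinct_card min_def)
  qed
  then show ?thesis
    unfolding pm_rank_eq[OF assms] excess_def sum_list_addf[symmetric]
    by (metis (mono_tags, lifting) map_eq_conv)
qed

lemma rank_reducing_iff:
  assumes "pm_valid B"
  shows "rank_reducing B k X \<longleftrightarrow> X \<subseteq> pm_ground B \<and> k \<le> excess B X"
  using pm_rank_Diff[OF assms, of X] unfolding rank_reducing_def by auto

text \<open>\<^term>\<open>overhead h B j\<close> is the smallest number of lost deletions in lowering the rank by j;
  h stands for infinity.\<close>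

fun overhead :: "nat \<Rightarrow> pm_model \<Rightarrow> nat \<Rightarrow> nat" where
  "overhead h [] j = (if j = 0 then 0 else h)"
| "overhead h (b # B) j =
     min (overhead h B j) (length (fst b) - snd b + overhead h B (j - snd b))"

text \<open>The amount \<^term>\<open>j - (j - d)\<close> is the minimum of j and d.\<close>

fun cover :: "nat \<Rightarrow> pm_model \<Rightarrow> nat \<Rightarrow> nat list" where
  "cover h [] j = []"
| "cover h (b # B) j =
     (if overhead h (b # B) j < overhead h B j
      then take (length (fst b) - snd b + (j - (j - snd b))) (fst b) @ cover h B (j - snd b)
      else cover h B j)"

section \<open>Correctness of the knapsack recursion and its traceback\<close>

lemma overhead_mono: "i \<le> j \<Longrightarrow> overhead h B i \<le> overhead h B j"
proof (induction B arbitrary: i j)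
  case (Cons b B)
  have "overhead h B i \<le> overhead h B j" "overhead h B (i - snd b) \<le> overhead h B (j - snd b)"
    using Cons by (auto intro!: Cons.IH)
  then show ?case by auto
qed auto

text \<open>The lower bound for every solution. A block with at most n - d deletions contributes
  nothing and can be skipped. Otherwise it pays n - d and contributes some c \<le> d; the recursion
  lowers the demand by d instead of c, which costs no more by \<open>overhead_mono\<close>.
  Admitting every j up to the excess lets the induction pass to the truncated \<open>j - c\<close>.
  For the empty list only j = 0 remains, so the value \<open>h\<close> never enters.\<close>

lemma overhead_le:
  assumes "\<forall>b \<in> set B. snd b \<le> length (fst b)" "j \<le> excess B X"
  shows "overhead h B j + excess B X \<le> (\<Sum>b\<leftarrow>B. card (set (fst b) \<inter> X))"
  using assms
proof (induction B arbitrary: j)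
  case (Cons b B)
  let ?x = "card (set (fst b) \<inter> X)" and ?n = "length (fst b)" and ?d = "snd b"
  let ?c = "?x - (?n - ?d)"
  have x: "?x \<le> ?n"
    by (metis card_length card_mono finite_set inf_le1 le_trans)
  have ex: "excess (b # B) X = ?c + excess B X"
    by (simp add: excess_def)
  have d: "?d \<le> ?n" using Cons.prems(1) by simp
  show ?case
  proof (cases "?x \<le> ?n - ?d")
    case True
    then show ?thesis using Cons.IH[of j] Cons.prems ex by auto
  next
    case False
    have "overhead h B (j - ?d) \<le> overhead h B (j - ?c)"
      by (rule overhead_mono) (use x d in auto)
    moreover have "overhead h B (j - ?c) + excess B X \<le> (\<Sum>b\<leftarrow>B. card (set (fst b) \<inter> X))"
      using Cons.IH[of "j - ?c"] Cons.prems ex by auto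
    moreover have "?x = ?n - ?d + ?c"
      using False by simp
    ultimately show ?thesis
      unfolding ex overhead.simps list.map sum_list.Cons by linarith
  qed
qed (simp add: excess_def)

lemma excess_mono: "X \<subseteq> Y \<Longrightarrow> excess B X \<le> excess B Y"
  unfolding excess_def by (intro sum_list_mono diff_le_mono card_mono) auto

text \<open>The bound by \<open>h\<close> is inherited along the traced path, so the path cannot end
  in an entry \<open>h\<close> of the empty list: the demand has dropped to 0 there.\<close>

lemma cover_correct:
  assumes "\<forall>b \<in> set B. distinct (fst b) \<and> snd b \<le> length (fst b)" "overhead h B j < h"
  shows "length (cover h B j) = overhead h B j + j" (is ?len)
    and "set (cover h B j) \<subseteq> pm_ground B" (is ?sub)
    and "j \<le> excess B (set (cover h B j))" (is ?exc)
proof -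
  have "?len \<and> ?sub \<and> ?exc"
    using assms
  proof (induction B arbitrary: j)
    case (Cons b B)
    let ?n = "length (fst b)" and ?d = "snd b"
    have ex: "excess (b # B) X = card (set (fst b) \<inter> X) - (?n - ?d) + excess B X" for X
      by (simp add: excess_def)
    show ?case
    proof (cases "overhead h (b # B) j < overhead h B j")
      case True
      let ?m = "j - (j - ?d)"
      let ?E = "take (?n - ?d + ?m) (fst b)" and ?C = "cover h B (j - ?d)"
      have less: "overhead h B (j - ?d) < h"
        using True Cons.prems(2) by simp
      have IH: "length ?C = overhead h B (j - ?d) + (j - ?d)" "set ?C \<subseteq> pm_ground B"
        "j - ?d \<le> excess B (set ?C)"
        using Cons.IH[of "j - ?d"] less Cons.prems(1) by simp_all
      have d: "?d \<le> ?n" and dis: "distinct (fst b)" using Cons.prems by auto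
      have E: "length ?E = ?n - ?d + ?m" using d by auto
      have "?n - ?d + ?m = card (set ?E)"
        using dis E by (simp only: distinct_card distinct_take)
      also have "\<dots> \<le> card (set (fst b) \<inter> set (?E @ ?C))"
        by (intro card_mono) (auto dest: in_set_takeD)
      finally have "?m \<le> card (set (fst b) \<inter> set (?E @ ?C)) - (?n - ?d)"
        by linarith
      \<comment> \<open>Adding the elements of \<open>?E\<close> can only raise the excess over the
        remaining blocks, so the two shares add up to at least j.\<close>
      moreover have "excess B (set ?C) \<le> excess B (set (?E @ ?C))"
        by (intro excess_mono) auto
      ultimately have "j \<le> excess (b # B) (set (?E @ ?C))"
        using IH(3) ex[of "set (?E @ ?C)"] by linarith
      moreover have "set (?E @ ?C) \<subseteq> pm_ground (b # B)"
        using IH(2) by (auto dest: in_set_takeD)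
      moreover have "overhead h (b # B) j = ?n - ?d + overhead h B (j - ?d)"
        using True by simp
      then have "length (?E @ ?C) = overhead h (b # B) j + j"
        unfolding length_append E IH(1) by linarith
      moreover have "cover h (b # B) j = ?E @ ?C"
        using True by (simp only: cover.simps if_True)
      ultimately show ?thesis by (simp only:)
    next
      case False
      then show ?thesis using Cons.IH[of j] Cons.prems ex by auto
    qed
  qed (auto split: if_splits)
  then show ?len ?sub ?exc by auto
qed

section \<open>A structured language on top of the machine\<close>

type_synonym mem = "nat \<Rightarrow> nat"

datatype com = Block "instr list" | Seq com com (infixr ";;" 60) | If nat com | While nat com

fun basic :: "instr \<Rightarrow> bool" where
  "basic (Jz _ _) = False"
| "basic (Jmp _) = False"
| "basic _ = True"

definition eff1 :: "instr \<Rightarrow> mem \<Rightarrow> mem" where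
  "eff1 i m = snd (exec i (0, m))"

lemma eff1_simps [simp]:
  "eff1 (Const a v) m = m(a := v)"
  "eff1 (Add a b c) m = m(a := m b + m c)"
  "eff1 (Sub a b c) m = m(a := m b - m c)"
  "eff1 (Load a b) m = m(a := m (m b))"
  "eff1 (Store a b) m = m(m a := m b)"
  by (simp_all add: eff1_def)

text \<open>The numeric argument is the number of machine steps; the second 1 of a loop iteration is
  the jump back.\<close>

inductive big :: "com \<Rightarrow> mem \<Rightarrow> nat \<Rightarrow> mem \<Rightarrow> bool" where
  Block: "list_all basic is \<Longrightarrow> big (Block is) m (length is) (fold eff1 is m)"
| Seq: "big c m t m' \<Longrightarrow> big c' m' t' m'' \<Longrightarrow> big (c ;; c') m (t + t') m''"
| IfFalse: "m a = 0 \<Longrightarrow> big (If a c) m 1 m"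
| IfTrue: "m a \<noteq> 0 \<Longrightarrow> big c m t m' \<Longrightarrow> big (If a c) m (1 + t) m'"
| WhileFalse: "m a = 0 \<Longrightarrow> big (While a c) m 1 m"
| WhileTrue: "m a \<noteq> 0 \<Longrightarrow> big c m t m' \<Longrightarrow> big (While a c) m' t' m'' \<Longrightarrow>
    big (While a c) m (1 + (t + (1 + t'))) m''"

section \<open>Compilation and its simulation proof\<close>

fun csize :: "com \<Rightarrow> nat" where
  "csize (Block is) = length is"
| "csize (c ;; c') = csize c + csize c'"
| "csize (If a c) = csize c + 1"
| "csize (While a c) = csize c + 2"

text \<open>Jump targets are absolute, hence the load address \<open>l\<close>. The offsets 1 and 2
  account for the test and for the jump that closes a loop.\<close>

fun compile :: "nat \<Rightarrow> com \<Rightarrow> instr list" where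
  "compile l (Block is) = is"
| "compile l (c ;; c') = compile l c @ compile (l + csize c) c'"
| "compile l (If a c) = Jz a (l + 1 + csize c) # compile (l + 1) c"
| "compile l (While a c) = Jz a (l + 2 + csize c) # compile (l + 1) c @ [Jmp l]"

lemma length_compile [simp]: "length (compile l c) = csize c"
  by (induction c arbitrary: l) auto

definition code_at :: "instr list \<Rightarrow> nat \<Rightarrow> instr list \<Rightarrow> bool" where
  "code_at P l c \<longleftrightarrow> (\<exists>xs ys. P = xs @ c @ ys \<and> length xs = l)"

lemma code_at_append:
  "code_at P l (c @ c') \<longleftrightarrow> code_at P l c \<and> code_at P (l + length c) c'"
proof
  assume "code_at P l (c @ c')"
  then obtain xs ys where "P = xs @ c @ c' @ ys" "length xs = l" by (auto simp: code_at_def)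
  then have "P = xs @ c @ (c' @ ys)" "P = (xs @ c) @ c' @ ys" "length xs = l"
    "length (xs @ c) = l + length c" by auto
  then show "code_at P l c \<and> code_at P (l + length c) c'"
    unfolding code_at_def by blast
next
  assume "code_at P l c \<and> code_at P (l + length c) c'"
  then obtain xs ys xs' ys' where P: "P = xs @ c @ ys" "length xs = l"
    "P = xs' @ c' @ ys'" "length xs' = l + length c"
    unfolding code_at_def by blast
  then have "(xs @ c) @ ys = xs' @ (c' @ ys')" "length (xs @ c) = length xs'" by simp_all
  then have "ys = c' @ ys'" using append_eq_append_conv by blast
  then have "P = xs @ (c @ c') @ ys'" using P(1) by simp
  then show "code_at P l (c @ c')" using P(2) unfolding code_at_def by blast
qed

lemma code_at_Cons:
  "code_at P l (i # c) \<longleftrightarrow> code_at P l [i] \<and> code_at P (Suc l) c"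
  using code_at_append[of P l "[i]" c] by simp

lemma run_add: "run P (t + t') s = run P t' (run P t s)"
  by (simp add: run_def funpow_add add.commute[of t t'])

lemma run_1: "code_at P l [i] \<Longrightarrow> run P 1 (l, m) = exec i (l, m)"
  by (auto simp: run_def step_def code_at_def nth_append)

lemma exec_basic: "basic i \<Longrightarrow> exec i (l, m) = (Suc l, eff1 i m)"
  by (cases i) auto

lemma run_block:
  "list_all basic is \<Longrightarrow> code_at P l is \<Longrightarrow> run P (length is) (l, m) = (l + length is, fold eff1 is m)"
proof (induction "is" arbitrary: l m)
  case Nil
  then show ?case by (simp add: run_def)
next
  case (Cons i "is")
  then have c: "code_at P l [i]" "code_at P (Suc l) is" and b: "basic i"
    by (auto simp: code_at_Cons[of P l i "is"])
  have "run P (1 + length is) (l, m) = (Suc l + length is, fold eff1 is (eff1 i m))"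
    unfolding run_add run_1[OF c(1)] exec_basic[OF b] using Cons.IH c(2) Cons.prems(1) by simp
  then show ?case by simp
qed

text \<open>The count in a derivation is the exact number of machine steps, so time bounds proved
  for structured programs carry over unchanged.\<close>

lemma big_run:
  "big c m t m' \<Longrightarrow> code_at P l (compile l c) \<Longrightarrow> run P t (l, m) = (l + csize c, m')"
proof (induction arbitrary: l rule: big.induct)
  case (Block "is" m)
  then show ?case by (simp add: run_block)
next
  case (Seq c m t m' c' t' m'')
  then show ?case by (simp add: run_add code_at_append add.assoc)
next
  case (IfFalse m a c)
  then have "code_at P l [Jz a (l + 1 + csize c)]"
    by (metis code_at_Cons compile.simps(3))
  from run_1[OF this] IfFalse show ?case by simp
next
  case (IfTrue m a c t m')
  then have c: "code_at P l [Jz a (l + 1 + csize c)]" "code_at P (l + 1) (compile (l + 1) c)"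
    by (metis code_at_Cons compile.simps(3) Suc_eq_plus1)+
  show ?case
    unfolding run_add run_1[OF c(1)] using IfTrue.IH[OF c(2)] IfTrue.hyps by simp
next
  case (WhileFalse m a c)
  then have "code_at P l [Jz a (l + 2 + csize c)]"
    by (metis code_at_Cons compile.simps(4))
  from run_1[OF this] WhileFalse show ?case by simp
next
  case (WhileTrue m a c t m' t' m'')
  then have c: "code_at P l [Jz a (l + 2 + csize c)]" "code_at P (l + 1) (compile (l + 1) c)"
    "code_at P (l + 1 + csize c) [Jmp l]"
    by (metis code_at_Cons code_at_append length_compile compile.simps(4) Suc_eq_plus1)+
  have "run P (1 + t) (l, m) = (l + 1 + csize c, m')"
    unfolding run_add run_1[OF c(1)] using WhileTrue.IH(1)[OF c(2)] WhileTrue.hyps by simp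
  then have "run P (1 + t + 1) (l, m) = (l, m')"
    unfolding run_add[of P "1 + t" 1] using run_1[OF c(3)] by simp
  then have "run P ((1 + t + 1) + t') (l, m) = run P t' (l, m')"
    by (simp only: run_add[of P "1 + t + 1" t'])
  then show ?case
    using WhileTrue.IH(2)[OF WhileTrue.prems] by (simp add: add.assoc)
qed

section \<open>Total correctness with running time\<close>

definition wp :: "com \<Rightarrow> nat \<Rightarrow> (mem \<Rightarrow> bool) \<Rightarrow> mem \<Rightarrow> bool" where
  "wp c T Q m \<longleftrightarrow> (\<exists>t \<le> T. \<exists>m'. big c m t m' \<and> Q m')"

lemma wp_conseq:
  assumes "wp c T Q m" "T \<le> T'" "\<And>m'. Q m' \<Longrightarrow> Q' m'"
  shows "wp c T' Q' m"
  using assms unfolding wp_def by (meson order_trans)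

lemma wp_block:
  assumes "list_all basic is" "length is \<le> T" "Q (fold eff1 is m)"
  shows "wp (Block is) T Q m"
  using assms big.Block unfolding wp_def by blast

lemma wp_seq:
  assumes "wp c T R m" "\<And>m'. R m' \<Longrightarrow> wp c' T' Q m'"
  shows "wp (c ;; c') (T + T') Q m"
  using assms unfolding wp_def by (meson add_mono big.Seq)

lemma wp_if:
  assumes "m a = 0 \<Longrightarrow> Q m" "m a \<noteq> 0 \<Longrightarrow> wp c T Q m"
  shows "wp (If a c) (T + 1) Q m"
proof (cases "m a = 0")
  case True
  then show ?thesis using assms(1) big.IfFalse unfolding wp_def by (meson le_add2)
next
  case False
  then obtain t m' where "t \<le> T" "big c m t m'" "Q m'" using assms(2) unfolding wp_def by blast
  then show ?thesis using big.IfTrue[of m a, OF False] unfolding wp_def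
    by (metis add.commute add_le_mono1)
qed

text \<open>Every loop of the program counts a register down to 0, so the invariant is indexed by
  the value of that register; this gives termination and the number of rounds at once. Each round
  adds 2 steps to its body, the test and the jump back, and the failing test is the final 1.\<close>

lemma wp_while:
  assumes "I n m"
    and "\<And>n m. I n m \<Longrightarrow> m a = n"
    and "\<And>n m. I (Suc n) m \<Longrightarrow> wp c T (I n) m"
  shows "wp (While a c) (n * (T + 2) + 1) (I 0) m"
  using assms(1)
proof (induction n arbitrary: m)
  case 0
  then have "big (While a c) m 1 m" using assms(2) by (intro big.WhileFalse) auto
  then show ?case using 0 unfolding wp_def by auto
next
  case (Suc n)
  obtain t m' where 1: "t \<le> T" "big c m t m'" "I n m'"
    using assms(3)[OF Suc.prems] unfolding wp_def by blast
  obtain t' m'' where 2: "t' \<le> n * (T + 2) + 1" "big (While a c) m' t' m''" "I 0 m''"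
    using Suc.IH[OF 1(3)] unfolding wp_def by blast
  have "big (While a c) m (1 + (t + (1 + t'))) m''"
    using 1 2 assms(2)[OF Suc.prems] by (intro big.WhileTrue) auto
  moreover have "1 + (t + (1 + t')) \<le> Suc n * (T + 2) + 1"
    using 1(1) 2(1) by simp
  ultimately show ?case using 2(3) unfolding wp_def by blast
qed

section \<open>The program\<close>

definition arr :: "mem \<Rightarrow> nat \<Rightarrow> nat list \<Rightarrow> bool" where
  "arr m a ws \<longleftrightarrow> (\<forall>i < length ws. m (a + i) = ws ! i)"

lemma arr_Nil [simp]: "arr m a []"
  by (simp add: arr_def)

lemma arr_Cons [simp]: "arr m a (w # ws) \<longleftrightarrow> m a = w \<and> arr m (Suc a) ws"
  by (auto simp: arr_def less_Suc_eq_0_disj)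

lemma arr_append [simp]: "arr m a (vs @ ws) \<longleftrightarrow> arr m a vs \<and> arr m (a + length vs) ws"
  by (induction vs arbitrary: a) auto

lemma arr_cong:
  assumes "arr m a ws" "\<And>x. a \<le> x \<Longrightarrow> x < a + length ws \<Longrightarrow> m' x = m x"
  shows "arr m' a ws"
  using assms by (auto simp: arr_def)

definition enc_block :: "nat list \<times> nat \<Rightarrow> nat list" where
  "enc_block b = length (fst b) # snd b # fst b"

lemma length_enc_block [simp]: "length (enc_block b) = 2 + length (fst b)"
  by (simp add: enc_block_def)

lemma enc_instance_eq: "enc_instance B k = k # length B # concat (map enc_block B)"
  by (auto simp: enc_instance_def enc_block_def case_prod_beta intro!: arg_cong[of _ _ concat])

text \<open>Row B of the table starts at address r. The word before it points to the encoding of the first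
  block of B, and the row of the remaining blocks lies k + 2 words below.\<close>

fun table :: "nat \<Rightarrow> nat \<Rightarrow> nat \<Rightarrow> mem \<Rightarrow> pm_model \<Rightarrow> nat \<Rightarrow> bool" where
  "table lo h k m [] r \<longleftrightarrow> lo \<le> r \<and> (\<forall>j\<le>k. m (r + j) = overhead h [] j)"
| "table lo h k m (b # B) r \<longleftrightarrow> lo + (k + 2) \<le> r \<and>
     (\<forall>j\<le>k. m (r + j) = overhead h (b # B) j) \<and>
     lo \<le> m (r - 1) \<and> m (r - 1) + length (enc_block b) \<le> r \<and> arr m (m (r - 1)) (enc_block b) \<and>
     table lo h k m B (r - (k + 2))"

lemma table_bound: "table lo h k m B r \<Longrightarrow> lo \<le> r"
  by (cases B) auto

lemma table_nth: "table lo h k m B r \<Longrightarrow> j \<le> k \<Longrightarrow> m (r + j) = overhead h B j"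
  by (cases B) auto

text \<open>The frame rule for tables: all rows, pointers and block encodings lie between
  \<open>lo\<close> and the end of the top row, so writes elsewhere are harmless.\<close>

lemma table_cong:
  assumes "table lo h k m B r" and m': "\<And>x. lo \<le> x \<Longrightarrow> x \<le> r + k \<Longrightarrow> m' x = m x"
  shows "table lo h k m' B r"
  using assms
proof (induction B arbitrary: r)
  case Nil
  then show ?case by simp
next
  case (Cons b B)
  note frame = Cons.prems(2)
  have t: "lo + (k + 2) \<le> r" "\<forall>j\<le>k. m (r + j) = overhead h (b # B) j" "lo \<le> m (r - 1)"
    "m (r - 1) + length (enc_block b) \<le> r" "arr m (m (r - 1)) (enc_block b)"
    "table lo h k m B (r - (k + 2))"
    using Cons.prems(1) unfolding table.simps by blast+
  have ptr: "m' (r - 1) = m (r - 1)"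
    by (rule frame) (use t(1) in linarith)+
  have "table lo h k m' B (r - (k + 2))"
    using t(6)
  proof (rule Cons.IH)
    show "m' x = m x" if "lo \<le> x" "x \<le> r - (k + 2) + k" for x
      by (rule frame) (use that t(1) in linarith)+
  qed
  moreover have "arr m' (m (r - 1)) (enc_block b)"
    using t(5)
  proof (rule arr_cong)
    show "m' x = m x" if "m (r - 1) \<le> x" "x < m (r - 1) + length (enc_block b)" for x
      by (rule frame) (use that t(3,4) in linarith)+
  qed
  moreover have "\<forall>j\<le>k. m' (r + j) = overhead h (b # B) j"
  proof (intro allI impI)
    fix j assume "j \<le> k"
    then have "m' (r + j) = m (r + j)"
      by (intro frame) (use t(1) in linarith)+
    then show "m' (r + j) = overhead h (b # B) j" using t(2) \<open>j \<le> k\<close> by (simp only:)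
  qed
  ultimately show ?case
    unfolding table.simps ptr using t(1,3,4) by blast
qed

text \<open>The input occupies the addresses that the program uses as registers 0 to 14, and its length N is
  the only known bound. Input word i, found at address i + 1, is moved to 32 N + i; the output grows
  from address 15 and the table from 64 N. Register 1 holds the constant 1, registers 2 and 5 the
  current amount j and the current row.\<close>

definition relocate :: com where
  "relocate =
     Block [Add 0 0 0, Add 0 0 0, Add 0 0 0, Add 0 0 0, Add 0 0 0, Store 0 1, Const 1 1] ;;
     Block (concat (map (\<lambda>j. [Add 0 0 1, Store 0 j]) [2..<15])) ;;
     Block [Const 3 28, Sub 3 0 3, Const 7 15] ;;
     While 3 (Block [Add 0 0 1, Load 4 7, Store 0 4, Add 7 7 1, Sub 3 3 1])"

text \<open>Infinity is the value that relocation leaves in register 0, namely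
  \<open>64 * N - 2\<close>, which exceeds every overhead that a feasible demand can have. The
  number of blocks is loaded twice: register 3 counts the pass that builds the table, register 14
  the pass that reads it.\<close>

definition first_row :: com where
  "first_row =
     Block [Load 2 7, Add 7 7 1, Load 3 7, Load 14 7, Add 7 7 1, Add 6 0 1, Add 5 6 1,
       Add 6 6 1, Const 12 0, Store 6 12, Add 6 6 1, Add 11 2 12, Add 4 2 1, Add 4 4 1] ;;
     While 11 (Block [Store 6 0, Add 6 6 1, Sub 11 11 1])"

text \<open>The minimum of x and y is computed as \<^term>\<open>x - (x - y)\<close>.\<close>

definition fill_row :: com where
  "fill_row = While 11 (Block [Sub 12 10 9, Add 12 12 5, Load 12 12, Add 12 12 8, Add 13 10 5,
     Load 13 13, Sub 12 13 12, Sub 12 13 12, Store 6 12, Add 6 6 1, Add 10 10 1, Sub 11 11 1])"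

text \<open>On entry register 6 points just past the current row; the pointer to the block goes
  there and the new row right behind it, which explains the row distance k + 2.\<close>

definition next_row :: com where
  "next_row =
     Block [Load 8 7, Store 6 7, Add 6 6 1, Add 7 7 1, Load 9 7, Add 7 7 1, Add 7 7 8, Sub 8 8 9,
       Const 10 0, Add 11 2 1] ;;
     fill_row ;;
     Block [Add 5 5 4, Sub 3 3 1]"

definition copy_out :: com where
  "copy_out = While 11 (Block [Load 12 7, Store 6 12, Add 7 7 1, Add 6 6 1, Sub 11 11 1])"

text \<open>Register 12 receives the truncated difference of the entries without and with the block.
  It is nonzero exactly when the strict test in \<open>cover\<close> succeeds, so a tie skips the
  block.\<close>

definition emit_block :: com where
  "emit_block =
     Block [Sub 12 5 1, Load 7 12, Add 13 5 2, Load 13 13, Sub 5 5 4, Add 12 5 2, Load 12 12,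
       Sub 12 12 13, Sub 14 14 1] ;;
     If 12
       (Block [Load 8 7, Add 7 7 1, Load 9 7, Add 7 7 1, Sub 8 8 9, Sub 9 2 9, Sub 2 2 9,
          Add 11 8 2, Const 8 0, Add 2 9 8] ;;
        copy_out)"

text \<open>The output format includes addresses 1 to 14; they are filled with copies of one element of the
  solution, which do not change the set that is output.\<close>

definition finish :: com where
  "finish = Block (Sub 0 6 1 # Const 1 15 # map (\<lambda>j. Load j 1) [2..<15] @ [Load 1 1])"

definition solver :: com where
  "solver = relocate ;; first_row ;; While 3 next_row ;; Block [Const 6 15] ;;
     While 14 emit_block ;; finish"

section \<open>Moving the input clear of the registers\<close>

lemma save_registers:
  assumes "n + 2 \<le> m 0" "m 1 = 1"
    and "m' = fold eff1 (concat (map (\<lambda>j. [Add 0 0 1, Store 0 j]) [2..<2 + n])) m"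
  shows "m' 0 = m 0 + n" "\<And>j. 2 \<le> j \<Longrightarrow> j < 2 + n \<Longrightarrow> m' (m 0 + j - 1) = m j"
    "\<And>x. x \<noteq> 0 \<Longrightarrow> x \<le> m 0 \<or> m 0 + n < x \<Longrightarrow> m' x = m x"
proof -
  have "m' 0 = m 0 + n \<and> (\<forall>j. 2 \<le> j \<longrightarrow> j < 2 + n \<longrightarrow> m' (m 0 + j - 1) = m j) \<and>
    (\<forall>x. x \<noteq> 0 \<longrightarrow> x \<le> m 0 \<or> m 0 + n < x \<longrightarrow> m' x = m x)"
    using assms
  proof (induction n arbitrary: m')
    case 0
    then show ?case by simp
  next
    case (Suc n)
    \<comment> \<open>Splitting off the last register leaves a shorter program of the same shape, so
      the 26 instructions are never executed symbolically.\<close>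
    define m1 where "m1 = fold eff1 (concat (map (\<lambda>j. [Add 0 0 1, Store 0 j]) [2..<2 + n])) m"
    have IH: "m1 0 = m 0 + n" "\<forall>j. 2 \<le> j \<longrightarrow> j < 2 + n \<longrightarrow> m1 (m 0 + j - 1) = m j"
      "\<forall>x. x \<noteq> 0 \<longrightarrow> x \<le> m 0 \<or> m 0 + n < x \<longrightarrow> m1 x = m x"
      using Suc.IH[OF _ Suc.prems(2) m1_def] Suc.prems(1) by auto
    have one: "m1 (Suc 0) = 1" using IH(3) Suc.prems by simp
    have upt: "[2..<2 + Suc n] = [2..<2 + n] @ [n + 2]" by simp
    have "m' = fold eff1 [Add 0 0 1, Store 0 (n + 2)] m1"
      unfolding Suc.prems(3) upt m1_def map_append concat_append fold_append by simp
    then have m': "m' = m1(0 := m 0 + n + 1, m 0 + n + 1 := m1 (n + 2))"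
      using IH(1) one by simp
    have n2: "m1 (Suc (Suc n)) = m (Suc (Suc n))" using IH(3) Suc.prems(1) by simp
    have "m' (m 0 + j - 1) = m j" if "2 \<le> j" "j < 2 + Suc n" for j
    proof (cases "j = n + 2")
      case True
      then show ?thesis by (simp add: m' n2)
    next
      case False
      then have "m 0 + j - 1 \<noteq> m 0 + n + 1" using that(1) by linarith
      moreover have "j < 2 + n" "m 0 + j - 1 \<noteq> 0" using that False Suc.prems(1) by linarith+
      ultimately show ?thesis using that IH(2) by (simp add: m')
    qed
    moreover have "m' x = m x" if "x \<noteq> 0" "x \<le> m 0 \<or> m 0 + Suc n < x" for x
      using that IH(3) by (auto simp: m')
    ultimately show ?case using IH(1) by (simp add: m')
  qed
  then show "m' 0 = m 0 + n" "\<And>j. 2 \<le> j \<Longrightarrow> j < 2 + n \<Longrightarrow> m' (m 0 + j - 1) = m j"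
    "\<And>x. x \<noteq> 0 \<Longrightarrow> x \<le> m 0 \<or> m 0 + n < x \<Longrightarrow> m' x = m x" by blast+
qed

text \<open>The value N has been overwritten by now, so the loop copies every address from 15 to
  \<open>M - 1\<close>, which includes the rest of the input. The sources end below M and the
  targets begin at \<open>M + 14\<close>, so no word is overwritten before it is read.\<close>

lemma wp_relocate_loop:
  assumes "15 \<le> M" "m 1 = 1" "m 0 = M + 13" "m 3 = M - 15" "m 7 = 15"
  shows "wp (While 3 (Block [Add 0 0 1, Load 4 7, Store 0 4, Add 7 7 1, Sub 3 3 1]))
    ((M - 15) * 7 + 1)
    (\<lambda>m'. m' 1 = 1 \<and> m' 7 = M \<and> m' 0 = 2 * M - 2 \<and>
      (\<forall>i. 15 \<le> i \<longrightarrow> i < M \<longrightarrow> m' (M - 1 + i) = m i) \<and>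
      (\<forall>i. 15 \<le> i \<longrightarrow> i < M + 14 \<longrightarrow> m' i = m i)) m"
proof -
  let ?body = "[Add 0 0 1, Load 4 7, Store 0 4, Add 7 7 1, Sub 3 3 1]"
  \<comment> \<open>Writing M as D + 2 keeps truncated subtraction out of the address
    arithmetic.\<close>
  define D where "D = M - 2"
  have D: "M = D + 2" "13 \<le> D" using assms(1) by (auto simp: D_def)
  define I where "I n m' \<longleftrightarrow> (\<exists>i. M = i + n \<and> 15 \<le> i \<and> m' 1 = 1 \<and> m' 3 = n \<and> m' 7 = i \<and>
    m' 0 = D + i \<and> (\<forall>x. 15 \<le> x \<longrightarrow> x < i \<longrightarrow> m' (D + 1 + x) = m x) \<and>
    (\<forall>x. 15 \<le> x \<longrightarrow> x < M + 14 \<longrightarrow> m' x = m x))" for n and m' :: mem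
  have "wp (While 3 (Block ?body)) ((M - 15) * (5 + 2) + 1) (I 0) m"
  proof (rule wp_while[of I])
    show "I (M - 15) m" using assms D unfolding I_def by (intro exI[of _ 15]) auto
    show "m 3 = n" if "I n m" for n m using that by (auto simp: I_def)
    fix n m1 assume *: "I (Suc n) m1"
    then obtain i where i: "M = i + Suc n" "15 \<le> i"
      and r: "m1 (Suc 0) = 1" "m1 3 = Suc n" "m1 7 = i" "m1 0 = D + i"
      and c: "\<And>x. 15 \<le> x \<Longrightarrow> x < i \<Longrightarrow> m1 (D + 1 + x) = m x"
        "\<And>x. 15 \<le> x \<Longrightarrow> x < M + 14 \<Longrightarrow> m1 x = m x"
      unfolding I_def by auto
    have eff: "fold eff1 ?body m1 =
      m1(0 := Suc (D + i), 4 := m1 i, Suc (D + i) := m1 i, 7 := Suc i, 3 := n)"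
      using r i D by simp
    have "m1 i = m i" using c(2) i by simp
    then have "I n (fold eff1 ?body m1)"
      unfolding eff I_def using i r c D by (intro exI[of _ "Suc i"]) (auto simp: less_Suc_eq)
    then show "wp (Block ?body) 5 (I n) m1" by (rule wp_block[rotated 2]) simp_all
  qed
  then show ?thesis
  proof (rule wp_conseq)
    have "M - 1 = D + 1" "2 * M - 2 = D + M" using D by simp_all
    then show "m' 1 = 1 \<and> m' 7 = M \<and> m' 0 = 2 * M - 2 \<and>
      (\<forall>i. 15 \<le> i \<longrightarrow> i < M \<longrightarrow> m' (M - 1 + i) = m i) \<and>
      (\<forall>i. 15 \<le> i \<longrightarrow> i < M + 14 \<longrightarrow> m' i = m i)" if "I 0 m'" for m'
      using that by (simp only: I_def) auto
  qed simp
qed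

lemma wp_relocate:
  assumes "ws \<noteq> []" "N = length ws"
  shows "wp relocate (100 + 224 * N)
    (\<lambda>m. m 1 = 1 \<and> m 7 = 32 * N \<and> m 0 = 64 * N - 2 \<and> arr m (32 * N) ws) (snd (init_state ws))"
proof -
  have N: "0 < N" using assms by simp
  define m0 where "m0 = snd (init_state ws)"
  have m0: "m0 0 = N" "\<And>i. i < N \<Longrightarrow> m0 (Suc i) = ws ! i"
    using assms by (auto simp: m0_def init_state_def)
  let ?M = "32 * N"
  let ?b1 = "[Add 0 0 0, Add 0 0 0, Add 0 0 0, Add 0 0 0, Add 0 0 0, Store 0 1, Const 1 1]"
  let ?b2 = "concat (map (\<lambda>j. [Add 0 0 1, Store 0 j]) [2..<15])"
  let ?b3 = "[Const 3 28, Sub 3 0 3, Const 7 15]"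
  define m1 where "m1 = fold eff1 ?b1 m0"
  \<comment> \<open>Addresses 1 to 14 may all hold input, so only register 0 can be changed safely:
    five doublings turn N into 32 N. Once the first word is stored, register 1 is free for the
    constant 1.\<close>
  have m1: "m1 = m0(0 := ?M, ?M := m0 1, 1 := 1)"
    using m0 N by (simp add: m1_def mult_2[symmetric])
  define m2 where "m2 = fold eff1 ?b2 m1"
  have m2: "m2 0 = ?M + 13" "\<And>j. 2 \<le> j \<Longrightarrow> j < 15 \<Longrightarrow> m2 (?M + j - 1) = m0 j"
    "\<And>x. x \<noteq> 0 \<Longrightarrow> x \<le> ?M \<or> ?M + 13 < x \<Longrightarrow> m2 x = m1 x"
    using save_registers[of 13 m1 m2] N by (auto simp: m1 m2_def)
  define m3 where "m3 = fold eff1 ?b3 m2"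
  \<comment> \<open>The constant 28 is 13 + 15: register 0 holds \<open>?M + 13\<close>, and the
    loop has to run \<open>?M - 15\<close> times.\<close>
  have m3: "m3 = m2(3 := ?M - 15, 7 := 15)"
    using m2(1) by (simp add: m3_def)
  have saved: "m3 (?M + i) = ws ! i" if "i < 14" "i < N" for i
  proof (cases "i = 0")
    case True
    then show ?thesis using m0(2)[of 0] m2(3)[of ?M] N by (simp add: m3 m1)
  next
    case False
    then show ?thesis using m0(2)[of i] m2(2)[of "i + 1"] that N by (simp add: m3)
  qed
  have kept: "m3 (Suc i) = ws ! i" if "14 \<le> i" "i < N" for i
    using that m2(3)[of "Suc i"] m0(2)[of i] by (simp add: m3 m1)
  have "wp relocate (7 + (26 + (3 + ((?M - 15) * 7 + 1))))
    (\<lambda>m. m 1 = 1 \<and> m 7 = ?M \<and> m 0 = 64 * N - 2 \<and> arr m ?M ws) m0"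
    unfolding relocate_def
  proof (rule wp_seq[of _ _ "\<lambda>m. m = m1"])
    show "wp (Block ?b1) 7 (\<lambda>m. m = m1) m0"
      by (rule wp_block) (simp, simp, simp only: m1_def)
    fix m assume m: "m = m1"
    show "wp (Block ?b2 ;; Block ?b3 ;; While 3 (Block [Add 0 0 1, Load 4 7, Store 0 4, Add 7 7 1, Sub 3 3 1]))
      (26 + (3 + ((?M - 15) * 7 + 1)))
      (\<lambda>m. m 1 = 1 \<and> m 7 = ?M \<and> m 0 = 64 * N - 2 \<and> arr m ?M ws) m"
    proof (rule wp_seq[of _ _ "\<lambda>m. m = m2"])
      show "wp (Block ?b2) 26 (\<lambda>m. m = m2) m"
        by (rule wp_block) (simp, simp, simp only: m m2_def)
      fix m assume m: "m = m2"
      show "wp (Block ?b3 ;; While 3 (Block [Add 0 0 1, Load 4 7, Store 0 4, Add 7 7 1, Sub 3 3 1]))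
        (3 + ((?M - 15) * 7 + 1))
        (\<lambda>m. m 1 = 1 \<and> m 7 = ?M \<and> m 0 = 64 * N - 2 \<and> arr m ?M ws) m"
      proof (rule wp_seq[of _ _ "\<lambda>m. m = m3"])
        show "wp (Block ?b3) 3 (\<lambda>m. m = m3) m"
          by (rule wp_block) (simp, simp, simp only: m m3_def)
        fix m assume m: "m = m3"
        have "m3 1 = 1" "m3 0 = ?M + 13" "m3 3 = ?M - 15" "m3 7 = 15"
          using m2(1) m2(3)[of 1] N by (simp_all add: m3 m1)
        from wp_relocate_loop[OF _ this] N
        have "wp (While 3 (Block [Add 0 0 1, Load 4 7, Store 0 4, Add 7 7 1, Sub 3 3 1]))
          ((?M - 15) * 7 + 1)
          (\<lambda>m'. m' 1 = 1 \<and> m' 7 = ?M \<and> m' 0 = 2 * ?M - 2 \<and>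
            (\<forall>i. 15 \<le> i \<longrightarrow> i < ?M \<longrightarrow> m' (?M - 1 + i) = m3 i) \<and>
            (\<forall>i. 15 \<le> i \<longrightarrow> i < ?M + 14 \<longrightarrow> m' i = m3 i)) m3" by simp
        then show "wp (While 3 (Block [Add 0 0 1, Load 4 7, Store 0 4, Add 7 7 1, Sub 3 3 1]))
          ((?M - 15) * 7 + 1)
          (\<lambda>m. m 1 = 1 \<and> m 7 = ?M \<and> m 0 = 64 * N - 2 \<and> arr m ?M ws) m"
          unfolding m
        proof (rule wp_conseq)
          fix m' assume *: "m' 1 = 1 \<and> m' 7 = ?M \<and> m' 0 = 2 * ?M - 2 \<and>
            (\<forall>i. 15 \<le> i \<longrightarrow> i < ?M \<longrightarrow> m' (?M - 1 + i) = m3 i) \<and>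
            (\<forall>i. 15 \<le> i \<longrightarrow> i < ?M + 14 \<longrightarrow> m' i = m3 i)"
          have "m' (?M + i) = ws ! i" if i: "i < N" for i
          proof (cases "i < 14")
            case True
            then have "m' (?M + i) = m3 (?M + i)" using * N by simp
            then show ?thesis using saved True i by simp
          next
            case False
            have "\<forall>i. 15 \<le> i \<longrightarrow> i < ?M \<longrightarrow> m' (?M - 1 + i) = m3 i"
              using * by blast
            moreover have "15 \<le> Suc i" "Suc i < ?M" using False i by simp_all
            ultimately have "m' (?M - 1 + Suc i) = m3 (Suc i)" by blast
            moreover have "?M - 1 + Suc i = ?M + i" using N by simp
            ultimately have "m' (?M + i) = m3 (Suc i)" by simp
            then show ?thesis using kept False i N by simp
          qed
          then show "m' 1 = 1 \<and> m' 7 = ?M \<and> m' 0 = 64 * N - 2 \<and> arr m' ?M ws"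
            using * assms by (simp add: arr_def)
        qed simp
      qed
    qed
  qed
  then show ?thesis
    unfolding m0_def by (rule wp_conseq) simp_all
qed

section \<open>Building the table and reading the solution off it\<close>

lemma wp_first_row:
  assumes "15 \<le> M" "m 1 = 1" "m 7 = M" "m 0 = 2 * M - 2" "arr m M (k # p # ws)" "2 + length ws \<le> M"
  shows "wp first_row (15 + 5 * k)
    (\<lambda>m. m 1 = 1 \<and> m 2 = k \<and> m 3 = p \<and> m 4 = k + 2 \<and> m 5 = 2 * M \<and> m 6 = 2 * M + k + 1 \<and>
      m 7 = M + 2 \<and> m 14 = p \<and> arr m (M + 2) ws \<and> table M (2 * M - 2) k m [] (2 * M)) m"
proof -
  let ?b1 = "[Load 2 7, Add 7 7 1, Load 3 7, Load 14 7, Add 7 7 1, Add 6 0 1, Add 5 6 1,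
       Add 6 6 1, Const 12 0, Store 6 12, Add 6 6 1, Add 11 2 12, Add 4 2 1, Add 4 4 1]"
  let ?b2 = "[Store 6 0, Add 6 6 1, Sub 11 11 1]"
  define H where "H = 2 * M - 2"
  have H: "2 * M = H + 2" "28 \<le> H" "m 0 = H" using assms(1,4) by (auto simp: H_def)
  define m1 where "m1 = fold eff1 ?b1 m"
  have kp: "m M = k" "m (Suc M) = p" "arr m (M + 2) ws" "m (Suc 0) = 1" using assms(2,5) by auto
  have m1: "m1 = m(2 := k, 3 := p, 14 := p, 7 := M + 2, 5 := H + 2, 12 := 0,
      H + 2 := 0, 6 := Suc (Suc (Suc H)), 11 := k, 4 := k + 2)"
    unfolding m1_def using kp assms(1,3) H by (simp add: fun_upd_twist)
  define I where "I n m' \<longleftrightarrow> (\<exists>i. k = i + n \<and> m' 6 = H + 3 + i \<and> m' 11 = n \<and>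
    (\<forall>x. H + 3 \<le> x \<longrightarrow> x < H + 3 + i \<longrightarrow> m' x = H) \<and>
    (\<forall>x. x \<noteq> 6 \<longrightarrow> x \<noteq> 11 \<longrightarrow> x < H + 3 \<longrightarrow> m' x = m1 x))" for n and m' :: mem
  have loop: "wp (While 11 (Block ?b2)) (k * (3 + 2) + 1) (I 0) m1"
  proof (rule wp_while[of I])
    show "I k m1" unfolding I_def using H by (intro exI[of _ 0]) (auto simp: m1)
    show "m 11 = n" if "I n m" for n m using that by (auto simp: I_def)
    fix n m2 assume "I (Suc n) m2"
    then obtain i where i: "k = i + Suc n" "m2 6 = H + 3 + i" "m2 11 = Suc n"
      and c: "\<forall>x. H + 3 \<le> x \<longrightarrow> x < H + 3 + i \<longrightarrow> m2 x = H"
        "\<forall>x. x \<noteq> 6 \<longrightarrow> x \<noteq> 11 \<longrightarrow> x < H + 3 \<longrightarrow> m2 x = m1 x"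
      unfolding I_def by blast
    have "m2 0 = H" "m2 (Suc 0) = 1" using c(2) H kp by (auto simp: m1)
    then have eff: "fold eff1 ?b2 m2 = m2(H + 3 + i := H, 6 := Suc (H + 3 + i), 11 := n)"
      using i H by simp
    have "I n (fold eff1 ?b2 m2)"
      unfolding eff I_def using i c H by (intro exI[of _ "Suc i"]) (auto simp: less_Suc_eq)
    then show "wp (Block ?b2) 3 (I n) m2" by (rule wp_block[rotated 2]) simp_all
  qed
  have "wp first_row (14 + (k * (3 + 2) + 1)) (I 0) m"
    unfolding first_row_def
  proof (rule wp_seq[of _ _ "\<lambda>m. m = m1"])
    show "wp (Block ?b1) 14 (\<lambda>m. m = m1) m"
      by (rule wp_block) (simp, simp, simp only: m1_def)
    show "wp (While 11 (Block ?b2)) (k * (3 + 2) + 1) (I 0) m'" if "m' = m1" for m'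
      unfolding that by (rule loop)
  qed
  then show ?thesis
  proof (rule wp_conseq)
    fix m' assume "I 0 m'"
    then have I: "m' 6 = H + 3 + k" "\<And>x. H + 3 \<le> x \<Longrightarrow> x < H + 3 + k \<Longrightarrow> m' x = H"
      "\<And>x. x \<noteq> 6 \<Longrightarrow> x \<noteq> 11 \<Longrightarrow> x < H + 3 \<Longrightarrow> m' x = m1 x"
      by (auto simp: I_def)
    have r: "m' 1 = 1" "m' 2 = k" "m' 3 = p" "m' 4 = k + 2" "m' 5 = H + 2" "m' 7 = M + 2" "m' 14 = p"
      "m' (H + 2) = 0"
      using H kp by (simp_all add: I(3) m1)
    have inp: "arr m' (M + 2) ws"
      using kp(3) by (rule arr_cong) (use assms(1,6) H in \<open>auto simp: I(3) m1\<close>)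
    have "m' (H + 2 + j) = H" if "j \<le> k" "j \<noteq> 0" for j
      using that by (intro I(2)) auto
    moreover have "M \<le> H + 2" using H(1) by linarith
    ultimately have "table M H k m' [] (2 * M)"
      using r(8) by (auto simp: H(1))
    then show "m' 1 = 1 \<and> m' 2 = k \<and> m' 3 = p \<and> m' 4 = k + 2 \<and> m' 5 = 2 * M \<and>
      m' 6 = 2 * M + k + 1 \<and> m' 7 = M + 2 \<and> m' 14 = p \<and> arr m' (M + 2) ws \<and>
      table M (2 * M - 2) k m' [] (2 * M)"
      using r I(1) inp by (simp add: H(1) H_def[symmetric])
  qed simp
qed

text \<open>The old row is an arbitrary function \<open>g\<close>. By \<open>r + k < q\<close> it
  ends before the new row begins, so it stays readable at both j and \<open>j - d\<close>
  throughout.\<close>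

lemma wp_fill_row:
  assumes "14 \<le> r" "r + k < q" "m 1 = 1" "m 5 = r" "m 6 = q" "m 8 = e" "m 9 = d" "m 10 = 0"
    "m 11 = k + 1" "\<And>j. j \<le> k \<Longrightarrow> m (r + j) = g j"
  shows "wp fill_row (15 + 14 * k)
    (\<lambda>m'. m' 6 = q + k + 1 \<and> (\<forall>j\<le>k. m' (q + j) = min (g j) (e + g (j - d))) \<and>
      (\<forall>x. x \<notin> {6, 10, 11, 12, 13} \<longrightarrow> x < q \<longrightarrow> m' x = m x)) m"
proof -
  let ?b = "[Sub 12 10 9, Add 12 12 5, Load 12 12, Add 12 12 8, Add 13 10 5,
     Load 13 13, Sub 12 13 12, Sub 12 13 12, Store 6 12, Add 6 6 1, Add 10 10 1, Sub 11 11 1]"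
  define I where "I n m' \<longleftrightarrow> (\<exists>i. k + 1 = i + n \<and> m' 6 = q + i \<and> m' 10 = i \<and> m' 11 = n \<and>
    (\<forall>j<i. m' (q + j) = min (g j) (e + g (j - d))) \<and>
    (\<forall>x. x \<notin> {6, 10, 11, 12, 13} \<longrightarrow> x < q \<longrightarrow> m' x = m x))" for n and m' :: mem
  have "wp fill_row ((k + 1) * (12 + 2) + 1) (I 0) m"
    unfolding fill_row_def
  proof (rule wp_while[of I])
    show "I (k + 1) m" unfolding I_def using assms by (intro exI[of _ 0]) auto
    show "m 11 = n" if "I n m" for n m using that by (auto simp: I_def)
    fix n m1 assume "I (Suc n) m1"
    then obtain i where i: "k + 1 = i + Suc n" "m1 6 = q + i" "m1 10 = i" "m1 11 = Suc n"
      and c: "\<forall>j<i. m1 (q + j) = min (g j) (e + g (j - d))"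
        "\<And>x. x \<notin> {6, 10, 11, 12, 13} \<Longrightarrow> x < q \<Longrightarrow> m1 x = m x"
      unfolding I_def by blast
    have r: "m1 (Suc 0) = 1" "m1 5 = r" "m1 8 = e" "m1 9 = d"
      using assms by (auto simp: c(2))
    have old: "m1 (r + j) = g j" if "j \<le> k" for j
      using assms that by (subst c(2)) auto
    have le: "i \<le> k" "i - d \<le> k" using i by auto
    have g: "m1 (i + r) = g i" "m1 (i - d + r) = g (i - d)"
      using old[OF le(1)] old[OF le(2)] by (simp_all add: add.commute)
    have mn: "g i - (g i - (g (i - d) + e)) = min (g i) (e + g (i - d))" by auto
    have eff: "fold eff1 ?b m1 = m1(12 := min (g i) (e + g (i - d)), 13 := g i,
        q + i := min (g i) (e + g (i - d)), 6 := q + i + 1, 10 := i + 1, 11 := n)"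
      using i r assms(1,2) g mn by (simp add: fun_upd_twist)
    have "I n (fold eff1 ?b m1)"
      unfolding eff I_def using i c assms(1,2) by (intro exI[of _ "Suc i"]) (auto simp: less_Suc_eq)
    then show "wp (Block ?b) 12 (I n) m1" by (rule wp_block[rotated 2]) simp_all
  qed
  then show ?thesis
    by (rule wp_conseq) (auto simp: I_def)
qed

lemma wp_copy_out:
  assumes "15 \<le> q" "q + length ws \<le> s" "m 1 = 1" "m 6 = q" "m 7 = s" "m 11 = length ws" "arr m s ws"
  shows "wp copy_out (7 * length ws + 1)
    (\<lambda>m'. m' 6 = q + length ws \<and> arr m' q ws \<and>
      (\<forall>x. x \<notin> {6, 7, 11, 12} \<longrightarrow> x < q \<or> q + length ws \<le> x \<longrightarrow> m' x = m x)) m"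
proof -
  let ?b = "[Load 12 7, Store 6 12, Add 7 7 1, Add 6 6 1, Sub 11 11 1]"
  define I where "I n m' \<longleftrightarrow> (\<exists>i. length ws = i + n \<and> m' 6 = q + i \<and> m' 7 = s + i \<and> m' 11 = n \<and>
    (\<forall>j<i. m' (q + j) = ws ! j) \<and>
    (\<forall>x. x \<notin> {6, 7, 11, 12} \<longrightarrow> x < q \<or> q + i \<le> x \<longrightarrow> m' x = m x))" for n and m' :: mem
  have "wp copy_out (length ws * (5 + 2) + 1) (I 0) m"
    unfolding copy_out_def
  proof (rule wp_while[of I])
    show "I (length ws) m" unfolding I_def using assms by (intro exI[of _ 0]) auto
    show "m 11 = n" if "I n m" for n m using that by (auto simp: I_def)
    fix n m1 assume "I (Suc n) m1"
    then obtain i where i: "length ws = i + Suc n" "m1 6 = q + i" "m1 7 = s + i" "m1 11 = Suc n"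
      and c: "\<forall>j<i. m1 (q + j) = ws ! j"
        "\<And>x. x \<notin> {6, 7, 11, 12} \<Longrightarrow> x < q \<or> q + i \<le> x \<Longrightarrow> m1 x = m x"
      unfolding I_def by blast
    have "m1 (Suc 0) = 1" using assms by (subst c(2)) auto
    moreover have "m1 (s + i) = m (s + i)" using assms i by (intro c(2)) auto
    then have "m1 (s + i) = ws ! i" using assms(7) i by (simp add: arr_def)
    ultimately have eff: "fold eff1 ?b m1 =
        m1(12 := ws ! i, q + i := ws ! i, 7 := s + i + 1, 6 := q + i + 1, 11 := n)"
      using i assms(1,2) by simp
    have "I n (fold eff1 ?b m1)"
      unfolding eff I_def using i c assms(1,2) by (intro exI[of _ "Suc i"]) (auto simp: less_Suc_eq)
    then show "wp (Block ?b) 5 (I n) m1" by (rule wp_block[rotated 2]) simp_all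
  qed
  then show ?thesis
    by (rule wp_conseq) (auto simp: I_def arr_def)
qed

text \<open>\<open>B1\<close> are the blocks already processed and \<open>B2\<close> those still to
  be read at register 7. Each new row puts its block in front, so the table belongs to
  \<open>rev B1\<close> and in the end to \<open>rev B\<close>. The last conjunct keeps the unread
  input below the current row.\<close>

definition rows_inv :: "nat \<Rightarrow> nat \<Rightarrow> nat \<Rightarrow> pm_model \<Rightarrow> nat \<Rightarrow> mem \<Rightarrow> bool" where
  "rows_inv lo h k B n m \<longleftrightarrow> (\<exists>B1 B2. B = B1 @ B2 \<and> n = length B2 \<and> m 1 = 1 \<and> m 2 = k \<and> m 3 = n \<and>
     m 4 = k + 2 \<and> m 6 = m 5 + k + 1 \<and> m 14 = length B \<and> table lo h k m (rev B1) (m 5) \<and> lo \<le> m 7 \<and>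
     arr m (m 7) (concat (map enc_block B2)) \<and> m 7 + length (concat (map enc_block B2)) \<le> m 5)"

lemma wp_next_row:
  assumes "15 \<le> lo" "rows_inv lo h k B (Suc n) m"
  shows "wp next_row (30 + 14 * k) (rows_inv lo h k B n) m"
proof -
  let ?b1 = "[Load 8 7, Store 6 7, Add 6 6 1, Add 7 7 1, Load 9 7, Add 7 7 1, Add 7 7 8, Sub 8 8 9,
       Const 10 0, Add 11 2 1]"
  let ?b2 = "[Add 5 5 4, Sub 3 3 1]"
  from assms(2) obtain B1 C where BC: "B = B1 @ C" "Suc n = length C"
    and inv: "m 1 = 1" "m 2 = k" "m 3 = Suc n" "m 4 = k + 2" "m 6 = m 5 + k + 1" "m 14 = length B"
      "table lo h k m (rev B1) (m 5)" "lo \<le> m 7" "arr m (m 7) (concat (map enc_block C))"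
      "m 7 + length (concat (map enc_block C)) \<le> m 5"
    unfolding rows_inv_def by blast
  obtain b B2 where C: "C = b # B2" using BC(2) by (cases C) auto
  have B: "B = B1 @ b # B2" "n = length B2"
    and r: "m (Suc 0) = 1" "m 2 = k" "m 3 = Suc n" "m 4 = k + 2" "m 14 = length B"
    and six: "m 6 = m 5 + k + 1"
    and tab: "table lo h k m (rev B1) (m 5)" and lo: "lo \<le> m 7"
    and inp: "arr m (m 7) (enc_block b @ concat (map enc_block B2))"
      "m 7 + (2 + length (fst b) + length (concat (map enc_block B2))) \<le> m 5"
    using BC inv by (simp_all add: C)
  define R p l d where "R = m 5" and "p = m 7" and "l = length (fst b)" and "d = snd b"
  have R: "m 5 = R" "m 7 = p" "m 6 = R + k + 1" and pd: "m p = l" "m (Suc p) = d"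
    and pR: "p + (2 + l) \<le> R" "lo \<le> p" "lo \<le> R"
    using inp lo six table_bound[OF tab] by (auto simp: R_def p_def l_def d_def enc_block_def)
  define m1 where "m1 = fold eff1 ?b1 m"
  have m1: "m1 = m(R + k + 1 := p, 6 := R + k + 2, 9 := d, 7 := p + 2 + l, 8 := l - d, 10 := 0, 11 := k + 1)"
    unfolding m1_def using r R pd pR assms(1) by (simp add: fun_upd_twist)
  have frame1: "m1 x = m x" if "15 \<le> x" "x \<noteq> R + k + 1" for x
    using that by (simp add: m1)
  have old: "m1 (R + j) = overhead h (rev B1) j" if "j \<le> k" for j
    using table_nth[OF tab that] frame1[of "R + j"] that pR assms(1) by (simp add: R_def)
  have fill: "wp fill_row (15 + 14 * k)
    (\<lambda>m'. m' 6 = (R + k + 2) + k + 1 \<and>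
      (\<forall>j\<le>k. m' (R + k + 2 + j) =
        min (overhead h (rev B1) j) (l - d + overhead h (rev B1) (j - d))) \<and>
      (\<forall>x. x \<notin> {6, 10, 11, 12, 13} \<longrightarrow> x < R + k + 2 \<longrightarrow> m' x = m1 x)) m1"
    by (rule wp_fill_row[of R]) (use assms(1) pR r R old in \<open>auto simp: m1\<close>)
  have "wp next_row (10 + ((15 + 14 * k) + 2)) (rows_inv lo h k B n) m"
    unfolding next_row_def
  proof (rule wp_seq[of _ _ "\<lambda>m. m = m1"])
    show "wp (Block ?b1) 10 (\<lambda>m. m = m1) m"
      by (rule wp_block) (simp, simp, simp only: m1_def)
    fix m' assume "m' = m1"
    then show "wp (fill_row ;; Block ?b2) ((15 + 14 * k) + 2) (rows_inv lo h k B n) m'"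
    proof (simp only:, intro wp_seq[OF fill])
      fix m2 assume *: "m2 6 = (R + k + 2) + k + 1 \<and>
        (\<forall>j\<le>k. m2 (R + k + 2 + j) =
          min (overhead h (rev B1) j) (l - d + overhead h (rev B1) (j - d))) \<and>
        (\<forall>x. x \<notin> {6, 10, 11, 12, 13} \<longrightarrow> x < R + k + 2 \<longrightarrow> m2 x = m1 x)"
      then have frame2: "\<And>x. x \<notin> {6, 10, 11, 12, 13} \<Longrightarrow> x < R + k + 2 \<Longrightarrow> m2 x = m1 x" by blast
      have r2: "m2 (Suc 0) = 1" "m2 2 = k" "m2 3 = Suc n" "m2 4 = k + 2" "m2 5 = R" "m2 7 = p + 2 + l"
        "m2 14 = length B" "m2 (R + k + 1) = p"
        using assms(1) pR r R by (simp_all add: frame2 m1)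
      define m3 where "m3 = fold eff1 ?b2 m2"
      have m3: "m3 = m2(5 := R + k + 2, 3 := n)"
        unfolding m3_def using r2 by simp
      \<comment> \<open>Apart from registers, everything is written at \<open>R + k + 1\<close> or
        above, so the old table and the input survive.\<close>
      have keep: "m3 x = m x" if "lo \<le> x" "x \<le> R + k" for x
        using that assms(1) frame2[of x] frame1[of x] by (simp add: m3)
      have row: "m3 (R + k + 2 + j) = overhead h (b # rev B1) j" if "j \<le> k" for j
        using that * pR assms(1) by (simp add: m3 l_def d_def)
      have "table lo h k m3 (rev B1) R"
        using tab unfolding R_def[symmetric] by (rule table_cong) (rule keep)
      moreover have "arr m3 p (enc_block b)"
        using inp(1) pR unfolding p_def[symmetric] by (auto intro!: arr_cong[of m] keep simp: l_def)
      moreover have "m3 (R + k + 1) = p"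
        using pR assms(1) r2 by (simp add: m3)
      ultimately have "table lo h k m3 (b # rev B1) (R + k + 2)"
        using row pR by (simp add: l_def)
      moreover have "arr m3 (p + 2 + l) (concat (map enc_block B2))"
      proof (rule arr_cong)
        show "arr m (p + 2 + l) (concat (map enc_block B2))"
          using inp(1) by (simp add: p_def l_def)
      qed (use inp(2) pR R in \<open>auto intro!: keep simp: l_def\<close>)
      moreover have "m3 (Suc 0) = 1" "m3 2 = k" "m3 3 = n" "m3 4 = k + 2" "m3 5 = R + k + 2"
        "m3 6 = R + k + 2 + k + 1" "m3 7 = p + 2 + l" "m3 14 = length B"
        using r2 * by (simp_all add: m3)
      ultimately have "rows_inv lo h k B n m3"
        unfolding rows_inv_def using B pR inp(2) R
        by (intro exI[of _ "B1 @ [b]"] exI[of _ B2]) (simp add: l_def)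
      then show "wp (Block ?b2) 2 (rows_inv lo h k B n) m2"
        unfolding m3_def by (rule wp_block[rotated 2]) simp_all
    qed
  qed
  then show ?thesis by (rule wp_conseq) simp_all
qed

text \<open>The output so far followed by the cover still to be traced is always the full solution
  \<open>C\<close>. The last conjunct reserves room below \<open>lo\<close> for all elements of the
  remaining blocks, so the output never reaches the input or the table.\<close>

definition emit_inv :: "nat \<Rightarrow> nat \<Rightarrow> nat \<Rightarrow> nat list \<Rightarrow> nat \<Rightarrow> mem \<Rightarrow> bool" where
  "emit_inv lo h k C n m \<longleftrightarrow> (\<exists>B out. n = length B \<and> m 1 = 1 \<and> m 4 = k + 2 \<and> m 14 = n \<and> m 2 \<le> k \<and>
     m 6 = 15 + length out \<and> arr m 15 out \<and> table lo h k m B (m 5) \<and> out @ cover h B (m 2) = C \<and>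
     (\<forall>b \<in> set B. snd b \<le> length (fst b)) \<and> 15 + length out + length (concat (map fst B)) \<le> lo)"

lemma wp_emit_block:
  assumes "emit_inv lo h k C (Suc n) m"
  shows "wp emit_block (25 + 7 * lo) (emit_inv lo h k C n) m"
proof -
  let ?b1 = "[Sub 12 5 1, Load 7 12, Add 13 5 2, Load 13 13, Sub 5 5 4, Add 12 5 2, Load 12 12,
       Sub 12 12 13, Sub 14 14 1]"
  let ?b2 = "[Load 8 7, Add 7 7 1, Load 9 7, Add 7 7 1, Sub 8 8 9, Sub 9 2 9, Sub 2 2 9,
          Add 11 8 2, Const 8 0, Add 2 9 8]"
  from assms obtain A out where A: "Suc n = length A"
    and inv: "m 1 = 1" "m 4 = k + 2" "m 14 = Suc n" "m 2 \<le> k" "m 6 = 15 + length out"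
      "arr m 15 out" "table lo h k m A (m 5)" "out @ cover h A (m 2) = C"
      "\<forall>b \<in> set A. snd b \<le> length (fst b)"
      "15 + length out + length (concat (map fst A)) \<le> lo"
    unfolding emit_inv_def by blast
  obtain b B where bB: "A = b # B" using A by (cases A) auto
  have B: "n = length B"
    and r: "m (Suc 0) = 1" "m 4 = k + 2" "m 14 = Suc n" "m 2 \<le> k" "m 6 = 15 + length out"
    and out: "arr m 15 out" and tab: "table lo h k m (b # B) (m 5)"
    and C: "out @ cover h (b # B) (m 2) = C"
    and le: "\<forall>b \<in> set B. snd b \<le> length (fst b)" "snd b \<le> length (fst b)"
    and room: "15 + length out + (length (fst b) + length (concat (map fst B))) \<le> lo"
    using A inv by (simp_all add: bB del: table.simps cover.simps)
  define j R p l d where "j = m 2" and "R = m 5 - (k + 2)" and "p = m (m 5 - 1)"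
    and "l = length (fst b)" and "d = snd b"
  have R: "m 5 = R + k + 2" "lo \<le> R" using tab by (auto simp: R_def)
  have p: "m (R + k + 1) = p" "lo \<le> p" "p + (2 + l) \<le> R + k + 2" "arr m p (enc_block b)"
    using tab R by (auto simp: p_def l_def)
  have pd: "m p = l" "m (Suc p) = d" "arr m (p + 2) (fst b)"
    using p(4) by (auto simp: enc_block_def l_def d_def)
  have j: "m 2 = j" "j \<le> k" using r by (auto simp: j_def)
  have tab': "table lo h k m B R" using tab R by simp
  have cells: "m (R + j) = overhead h B j" "m (R + k + 2 + j) = overhead h (b # B) j"
    using table_nth[OF tab' j(2)] table_nth[OF tab j(2)] R by (simp_all add: ac_simps)
  have ld: "d \<le> l" using le by (simp add: l_def d_def)
  have lo15: "15 \<le> lo" using room by simp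
  define D where "D = overhead h B j - overhead h (b # B) j"
  define m1 where "m1 = fold eff1 ?b1 m"
  have m1: "m1 = m(7 := p, 13 := overhead h (b # B) j, 5 := R, 12 := D, 14 := n)"
    unfolding m1_def D_def using r(1-3) R p(1) j(1) cells lo15
    by (simp add: fun_upd_twist del: overhead.simps)
  have frame1: "m1 x = m x" if "15 \<le> x" for x
    using that by (simp add: m1)
  have tab1: "table lo h k m' B R" if "\<And>x. lo \<le> x \<Longrightarrow> m' x = m x" for m'
    using tab' by (rule table_cong) (rule that)
  have "wp emit_block (9 + ((10 + (7 * lo + 1)) + 1)) (emit_inv lo h k C n) m"
    unfolding emit_block_def
  proof (rule wp_seq[of _ _ "\<lambda>m. m = m1"])
    show "wp (Block ?b1) 9 (\<lambda>m. m = m1) m"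
      by (rule wp_block) (simp, simp, simp only: m1_def)
    fix m' assume "m' = m1"
    moreover have "wp (If 12 (Block ?b2 ;; copy_out)) ((10 + (7 * lo + 1)) + 1) (emit_inv lo h k C n) m1"
    proof (rule wp_if)
      assume "m1 12 = 0"
      then have "cover h (b # B) j = cover h B j"
        by (simp add: m1 D_def)
      moreover have "arr m1 15 out"
        using out by (rule arr_cong) (simp add: frame1)
      moreover have "table lo h k m1 B R"
        by (rule tab1) (use lo15 in \<open>simp add: frame1\<close>)
      ultimately show "emit_inv lo h k C n m1"
        unfolding emit_inv_def using B r j C le(1) room
        by (intro exI[of _ B] exI[of _ out]) (simp add: m1)
    next
      assume "m1 12 \<noteq> 0"
      then have less: "overhead h (b # B) j < overhead h B j"
        by (simp add: m1 D_def)
      define ws where "ws = take (l - d + (j - (j - d))) (fst b)"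
      have cov: "cover h (b # B) j = ws @ cover h B (j - d)"
        using less by (simp only: cover.simps if_True ws_def l_def d_def)
      have len: "length ws = l - d + (j - (j - d))" "length ws \<le> l"
        using ld by (auto simp: ws_def l_def)
      define m2 where "m2 = fold eff1 ?b2 m1"
      have m2: "m2 = m1(7 := p + 2, 9 := j - d, 11 := length ws, 8 := 0, 2 := j - d)"
        unfolding m2_def using r(1) j(1) p(2) pd(1,2) lo15 len(1) by (simp add: m1 fun_upd_twist)
      have frame2: "m2 x = m x" if "15 \<le> x" for x
        using that by (simp add: m2 frame1)
      have "arr m (p + 2) ws"
        using pd(3) by (auto simp: arr_def ws_def)
      then have src: "arr m2 (p + 2) ws"
        by (rule arr_cong) (use p(2) lo15 in \<open>simp add: frame2\<close>)
      have "m2 1 = 1" "m2 6 = 15 + length out" "m2 7 = p + 2" "m2 11 = length ws"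
        using r by (simp_all add: m2 m1 del: overhead.simps)
      moreover have "15 \<le> 15 + length out" "15 + length out + length ws \<le> p + 2"
        using room len(2) p(2) unfolding l_def by linarith+
      ultimately have copy: "wp copy_out (7 * length ws + 1)
        (\<lambda>m'. m' 6 = 15 + length out + length ws \<and> arr m' (15 + length out) ws \<and>
          (\<forall>x. x \<notin> {6, 7, 11, 12} \<longrightarrow> x < 15 + length out \<or> 15 + length out + length ws \<le> x \<longrightarrow>
            m' x = m2 x)) m2"
        by (intro wp_copy_out[where s = "p + 2"] src)
      show "wp (Block ?b2 ;; copy_out) (10 + (7 * lo + 1)) (emit_inv lo h k C n) m1"
      proof (rule wp_seq[of _ _ "\<lambda>m. m = m2"])
        show "wp (Block ?b2) 10 (\<lambda>m. m = m2) m1"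
          by (rule wp_block) (simp, simp, simp only: m2_def)
        show "wp copy_out (7 * lo + 1) (emit_inv lo h k C n) m'" if "m' = m2" for m'
          unfolding that using copy
        proof (rule wp_conseq)
          \<comment> \<open>The reserved room also bounds the size of a single block by
            \<open>lo\<close>; this crude bound suffices for the running time.\<close>
          show "7 * length ws + 1 \<le> 7 * lo + 1" using len(2) room by (simp add: l_def)
          fix m3 assume *: "m3 6 = 15 + length out + length ws \<and> arr m3 (15 + length out) ws \<and>
            (\<forall>x. x \<notin> {6, 7, 11, 12} \<longrightarrow> x < 15 + length out \<or> 15 + length out + length ws \<le> x \<longrightarrow>
              m3 x = m2 x)"
          then have frame3: "m3 x = m2 x"
            if "x \<notin> {6, 7, 11, 12}" "x < 15 + length out \<or> 15 + length out + length ws \<le> x" for x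
            using that by blast
          have "arr m3 15 (out @ ws)"
            using * out by (auto intro!: arr_cong[of m 15 out] simp: frame3 frame2)
          moreover have "table lo h k m3 B R"
            by (rule tab1) (use len(2) room in \<open>simp add: frame3 frame2 l_def\<close>)
          moreover have "m3 (Suc 0) = 1" "m3 2 = j - d" "m3 4 = k + 2" "m3 5 = R" "m3 14 = n"
            using r(1,2) by (simp_all add: frame3 m2 m1)
          ultimately show "emit_inv lo h k C n m3"
            unfolding emit_inv_def using B j(2) C[unfolded j(1)] le(1) room len(2) * cov
            by (intro exI[of _ B] exI[of _ "out @ ws"]) (simp add: l_def)
        qed
      qed
    qed
    ultimately show "wp (If 12 (Block ?b2 ;; copy_out)) ((10 + (7 * lo + 1)) + 1) (emit_inv lo h k C n) m'"
      by (simp only:)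
  qed
  then show ?thesis by (rule wp_conseq) simp_all
qed

lemma wp_finish:
  assumes "m 1 = 1" "m 6 = 15 + length out" "arr m 15 out" "out \<noteq> []"
  shows "wp finish 20 (\<lambda>m'. \<forall>pc. set (ram_output (pc, m')) = set out) m"
proof -
  \<comment> \<open>Output starts at address 1, so its length is the end pointer minus 1. Register 1
    holds the address 15 from which the padding is loaded, hence it is overwritten last.\<close>
  let ?b = "Sub 0 6 1 # Const 1 15 # map (\<lambda>j. Load j 1) [2..<15] @ [Load 1 1]"
  define m' where "m' = fold eff1 ?b m"
  have "wp finish 16 (\<lambda>m. m = m') m"
    unfolding finish_def by (rule wp_block) (simp, simp, simp only: m'_def)
  moreover have "set (ram_output (pc, m')) = set out" for pc
  proof -
    have upt: "[2..<15] = [2, 3, 4, 5, 6, 7, 8, 9, 10, 11, 12, 13, 14 :: nat]" by (simp add: upt_rec)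
    have m15: "m 15 = hd out"
      using assms(3,4) by (cases out) auto
    have m': "m' 0 = 14 + length out" "\<And>i. i < 14 \<Longrightarrow> m' (Suc i) = hd out"
      "\<And>i. i < length out \<Longrightarrow> m' (15 + i) = out ! i"
      using assms m15 unfolding m'_def upt
      by (auto simp: arr_def numeral_eq_Suc less_Suc_eq)
    have "{..<14 + length out} = {..<14} \<union> (\<lambda>i. 14 + i) ` {..<length out}"
      by (auto simp: image_iff) (metis le_Suc_ex lessThan_iff nat_add_left_cancel_less not_less)
    then have "set (ram_output (pc, m')) =
      (\<lambda>i. m' (Suc i)) ` {..<14} \<union> (\<lambda>i. m' (15 + i)) ` {..<length out}"
      by (simp add: ram_output_def m'(1) atLeast0LessThan image_Un image_image)
    also have "(\<lambda>i. m' (Suc i)) ` {..<14} = {hd out}"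
      using m'(2) by (simp add: image_constant_conv lessThan_empty_iff cong: image_cong_simp)
    also have "(\<lambda>i. m' (15 + i)) ` {..<length out} = set out"
      using m'(3) by (auto simp: in_set_conv_nth image_iff)
    finally show ?thesis using assms(4) by auto
  qed
  ultimately show ?thesis by (elim wp_conseq) auto
qed

text \<open>The dominant costs are one row of k + 1 entries per block and one copy of at most 32 N
  words per block. Both are quadratic in N because neither k nor the number of blocks exceeds
  N.\<close>

lemma wp_solver:
  assumes "pm_valid B" "N = length (enc_instance B k)" "h = 64 * N - 2" "k \<le> N"
    "cover h (rev B) k \<noteq> []"
  shows "wp solver (1000 * (N + 1) ^ 2)
    (\<lambda>m. \<forall>pc. set (ram_output (pc, m)) = set (cover h (rev B) k)) (snd (init_state (enc_instance B k)))"
proof -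
  let ?ws = "concat (map enc_block B)" and ?C = "cover h (rev B) k" and ?p = "length B"
  let ?M = "32 * N"
  let ?Q = "\<lambda>m. \<forall>pc. set (ram_output (pc, m)) = set ?C"
  have N: "N = 2 + length ?ws" using assms(2) by (simp add: enc_instance_eq)
  have len_ws: "length ?ws = 2 * ?p + length (concat (map fst B))"
    by (induction B) simp_all
  have le: "\<forall>b \<in> set B. snd b \<le> length (fst b)" using assms(1) by (simp add: pm_valid_def)
  define T where "T = (100 + 224 * N) + ((15 + 5 * k) + ((?p * ((30 + 14 * k) + 2) + 1) +
    (1 + ((?p * ((25 + 7 * ?M) + 2) + 1) + 20))))"
  have "wp solver T ?Q (snd (init_state (enc_instance B k)))"
    unfolding solver_def T_def
  proof (rule wp_seq[OF wp_relocate[OF _ assms(2)]])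
    show "enc_instance B k \<noteq> []" by (simp add: enc_instance_eq)
    fix m assume *: "m 1 = 1 \<and> m 7 = 32 * N \<and> m 0 = 64 * N - 2 \<and> arr m (32 * N) (enc_instance B k)"
    have first: "wp first_row (15 + 5 * k) (\<lambda>m. m 1 = 1 \<and> m 2 = k \<and> m 3 = ?p \<and> m 4 = k + 2 \<and>
      m 5 = 2 * ?M \<and> m 6 = 2 * ?M + k + 1 \<and> m 7 = ?M + 2 \<and> m 14 = ?p \<and> arr m (?M + 2) ?ws \<and>
      table ?M (2 * ?M - 2) k m [] (2 * ?M)) m"
      by (rule wp_first_row) (use * N in \<open>simp_all add: enc_instance_eq\<close>)
    show "wp (first_row ;; While 3 next_row ;; Block [Const 6 15] ;; While 14 emit_block ;; finish)
      ((15 + 5 * k) + ((?p * ((30 + 14 * k) + 2) + 1) + (1 + ((?p * ((25 + 7 * ?M) + 2) + 1) + 20)))) ?Q m"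
    proof (rule wp_seq[OF first])
      fix m assume *: "m 1 = 1 \<and> m 2 = k \<and> m 3 = ?p \<and> m 4 = k + 2 \<and>
        m 5 = 2 * ?M \<and> m 6 = 2 * ?M + k + 1 \<and> m 7 = ?M + 2 \<and> m 14 = ?p \<and> arr m (?M + 2) ?ws \<and>
        table ?M (2 * ?M - 2) k m [] (2 * ?M)"
      have "rows_inv ?M h k B ?p m"
        unfolding rows_inv_def using * N assms(3)
        by (intro exI[of _ "[]"] exI[of _ B]) simp
      then have rows: "wp (While 3 next_row) (?p * ((30 + 14 * k) + 2) + 1) (rows_inv ?M h k B 0) m"
      proof (rule wp_while[of "rows_inv ?M h k B"])
        show "m 3 = n" if "rows_inv ?M h k B n m" for n m
          using that by (auto simp: rows_inv_def)
      qed (use N in \<open>auto intro: wp_next_row\<close>)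
      show "wp (While 3 next_row ;; Block [Const 6 15] ;; While 14 emit_block ;; finish)
        ((?p * ((30 + 14 * k) + 2) + 1) + (1 + ((?p * ((25 + 7 * ?M) + 2) + 1) + 20))) ?Q m"
      proof (rule wp_seq[OF rows])
        fix m assume "rows_inv ?M h k B 0 m"
        then have *: "m (Suc 0) = 1" "m 2 = k" "m 4 = k + 2" "m 14 = ?p" "table ?M h k m (rev B) (m 5)"
          by (auto simp: rows_inv_def)
        have "table ?M h k (m(6 := 15)) (rev B) (m 5)"
          using *(5) by (rule table_cong) (use N in auto)
        then have "emit_inv ?M h k ?C ?p (m(6 := 15))"
          unfolding emit_inv_def using * le N len_ws
          by (intro exI[of _ "rev B"] exI[of _ "[]"]) (simp add: rev_map[symmetric] rev_concat sum_list_rev length_concat)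
        then have start: "wp (Block [Const 6 15]) 1 (emit_inv ?M h k ?C ?p) m"
          by (intro wp_block) simp_all
        show "wp (Block [Const 6 15] ;; While 14 emit_block ;; finish)
          (1 + ((?p * ((25 + 7 * ?M) + 2) + 1) + 20)) ?Q m"
        proof (rule wp_seq[OF start])
          fix m assume "emit_inv ?M h k ?C ?p m"
          then have emit: "wp (While 14 emit_block) (?p * ((25 + 7 * ?M) + 2) + 1) (emit_inv ?M h k ?C 0) m"
          proof (rule wp_while[of "emit_inv ?M h k ?C"])
            show "m 14 = n" if "emit_inv ?M h k ?C n m" for n m
              using that by (auto simp: emit_inv_def)
          qed (rule wp_emit_block)
          show "wp (While 14 emit_block ;; finish) ((?p * ((25 + 7 * ?M) + 2) + 1) + 20) ?Q m"
          proof (rule wp_seq[OF emit])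
            fix m assume "emit_inv ?M h k ?C 0 m"
            then have "m 1 = 1" "m 6 = 15 + length ?C" "arr m 15 ?C"
              by (auto simp: emit_inv_def)
            then show "wp finish 20 ?Q m"
              using assms(5) by (rule wp_finish)
          qed
        qed
      qed
    qed
  qed
  then show ?thesis
  proof (rule wp_conseq)
    have p: "?p \<le> N" using N len_ws by simp
    have "?p * ((30 + 14 * k) + 2) \<le> N * (32 + 14 * N)"
      using p assms(4) by (intro mult_mono) auto
    moreover have "?p * ((25 + 7 * ?M) + 2) \<le> N * (27 + 224 * N)"
      using p by (intro mult_mono) auto
    ultimately have "T \<le> 138 + 229 * N + N * (32 + 14 * N) + N * (27 + 224 * N)"
      unfolding T_def using assms(4) by linarith
    also have "\<dots> \<le> 1000 * (N + 1) ^ 2"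
      by (simp add: power2_eq_square algebra_simps)
    finally show "T \<le> 1000 * (N + 1) ^ 2" .
  qed
qed

lemma length_le_enc_size: "length ws \<le> enc_size ws"
  unfolding enc_size_def by (induction ws) (simp_all del: bitlen.simps)

theorem theorem1:
  shows "\<exists>(P :: instr list) (c :: nat) (e :: nat).
    \<forall>(B :: pm_model) (k :: nat).
      pm_valid B \<and> 0 < k \<and> (\<exists>Y. rank_reducing B k Y) \<longrightarrow>
      (\<exists>t \<le> c * (enc_size (enc_instance B k) + 1) ^ e.
         halted P (run P t (init_state (enc_instance B k))) \<and>
         (let X = set (ram_output (run P t (init_state (enc_instance B k)))) in
            rank_reducing B k X \<and> (\<forall>Y. rank_reducing B k Y \<longrightarrow> card X \<le> card Y)))"
proof (rule exI[of _ "compile 0 solver"], rule exI[of _ 1000], rule exI[of _ 2], intro allI impI)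
  fix B k
  let ?P = "compile 0 solver" and ?ws = "enc_instance B k"
  assume *: "pm_valid B \<and> 0 < k \<and> (\<exists>Y. rank_reducing B k Y)"
  then have v: "pm_valid B" and k: "0 < k" by auto
  define N where "N = length ?ws"
  define h where "h = 64 * N - 2"
  let ?C = "cover h (rev B) k"
  have N: "N = 2 + (2 * length B + length (concat (map fst B)))"
    unfolding N_def enc_instance_eq by (induction B) simp_all
  have ground: "card (pm_ground B) \<le> N - 2"
    using card_length[of "concat (map fst B)"] N unfolding pm_ground_eq by linarith
  have blocks: "\<forall>b \<in> set B. distinct (fst b) \<and> snd b \<le> length (fst b)"
    using v by (auto simp: pm_valid_def distinct_concat_iff)
  have excess_rev: "excess (rev B) X = excess B X" for X
    by (simp add: excess_def rev_map[symmetric] sum_list_rev)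
  \<comment> \<open>A feasible instance bounds more than the optimum: any solution lies in the
    ground set, which has at most \<open>N - 2\<close> elements. Hence the overhead is below
    \<open>h\<close>, and k is at most N.\<close>
  have lower: "overhead h (rev B) k + k \<le> card Y" and small: "overhead h (rev B) k + k \<le> N - 2"
    if "rank_reducing B k Y" for Y
  proof -
    have Y: "Y \<subseteq> pm_ground B" "k \<le> excess B Y" using that by (simp_all add: rank_reducing_iff[OF v])
    have "overhead h (rev B) k + excess (rev B) Y \<le> (\<Sum>b\<leftarrow>rev B. card (set (fst b) \<inter> Y))"
      by (rule overhead_le) (use blocks Y(2) excess_rev in auto)
    also have "\<dots> = card (pm_ground B \<inter> Y)"
      unfolding card_Int_pm_ground[OF v] by (simp add: rev_map[symmetric] sum_list_rev)
    also have "pm_ground B \<inter> Y = Y" using Y(1) by auto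
    finally show "overhead h (rev B) k + k \<le> card Y"
      using Y(2) by (simp add: excess_rev)
    also have "card Y \<le> card (pm_ground B)"
      using Y(1) by (intro card_mono) auto
    finally show "overhead h (rev B) k + k \<le> N - 2" using ground by simp
  qed
  have fin: "overhead h (rev B) k < h" "k \<le> N"
  proof -
    from * obtain Y where "rank_reducing B k Y" by blast
    with small have "overhead h (rev B) k + k \<le> N - 2" by blast
    then show "overhead h (rev B) k < h" "k \<le> N" using N unfolding h_def by linarith+
  qed
  note C = cover_correct[of "rev B" h k, OF _ fin(1)]
  have C: "length ?C = overhead h (rev B) k + k" "set ?C \<subseteq> pm_ground B" "k \<le> excess B (set ?C)"
    using C blocks by (simp_all add: excess_rev pm_ground_def)
  \<comment> \<open>A positive k provides the element with which the register addresses are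
    padded.\<close>
  have "?C \<noteq> []" using C(1) k by auto
  from wp_solver[OF v N_def h_def fin(2) this] obtain t m
    where t: "t \<le> 1000 * (N + 1) ^ 2" and big: "big solver (snd (init_state ?ws)) t m"
      and out: "\<And>pc. set (ram_output (pc, m)) = set ?C"
    unfolding wp_def by blast
  have "code_at ?P 0 ?P" unfolding code_at_def by (intro exI[of _ "[]"]) simp
  from big_run[OF big this] have run: "run ?P t (init_state ?ws) = (csize solver, m)"
    by (simp add: init_state_def)
  have "t \<le> 1000 * (enc_size ?ws + 1) ^ 2"
    using t length_le_enc_size[of ?ws] unfolding N_def[symmetric]
    by (meson order_trans mult_le_mono2 power_mono add_le_mono1 zero_le)
  moreover have "halted ?P (run ?P t (init_state ?ws))"
    by (simp add: halted_def run)
  moreover have "rank_reducing B k (set ?C)"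
    using C by (simp add: rank_reducing_iff[OF v])
  \<comment> \<open>The length of the list bounds the cardinality from above and equals the lower
    bound for every solution.\<close>
  moreover have "card (set ?C) \<le> card Y" if "rank_reducing B k Y" for Y
    using card_length[of ?C] C(1) lower[OF that] by simp
  ultimately show "\<exists>t \<le> 1000 * (enc_size ?ws + 1) ^ 2. halted ?P (run ?P t (init_state ?ws)) \<and>
    (let X = set (ram_output (run ?P t (init_state ?ws))) in
      rank_reducing B k X \<and> (\<forall>Y. rank_reducing B k Y \<longrightarrow> card X \<le> card Y))"
    unfolding Let_def by (intro exI[of _ t]) (simp add: run out)
qed

end
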